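(* A proper bounded weighted shift $S_\lambda$ on a directed forest $\mathcal T=(V,p)$ is power hyponormal if and only if the following two conditions are satisfied: (a) the forest $\mathcal T$ is leafless; (b) $\mathtt h_k(v)\le 1$ for every $v\in V$ and every integer $k\ge1$, where $$\mathtt h_k(v):=\sum_{u\in\mathrm{Chi}^{\langle k\rangle}(v)}\frac{|\lambda_u^{(k)}|^2}{\|S_\lambda^k e_u\|^2}.$$
   Context: A directed forest is a pair $\mathcal T=(V,p)$ where $V$ is a nonempty set and $p:V\to V$ is a function such that $p^n(v)=v$ with $n\ge 1$ implies $p(v)=v$. $\mathrm{root}(\mathcal T)=\{v\in V:p(v)=v\}$. For $k\ge1$, $\mathrm{Chi}^{\langle k\rangle}(v)=\{u\in V:p^k(u)=v\ne p^{k-1}(u)\}$. The forest is leafless if $p(V)=V$. $\ell^2(V)$ is the complex Hilbert space of square-summable functions on $V$ with canonical orthonormal basis $\{e_v\}_{v\in V}$. A system of weights on $\mathcal T$ is $\lambda=\{\lambda_v\}_{v\in V}\subseteq\mathbb C$ with $\lambda_v=0$ for every root $v$. The weighted shift $S_\lambda$ on $\mathcal T$ is the operator in $\ell^2(V)$ given by $(S_\lambda f)(v)=\lambda_v f(p(v))$ (with maximal domain). It is proper if $\{v:\lambda_v=0\}=\mathrm{root}(\mathcal T)$. Put $\lambda^{(0)}_v=1$ and $\lambda^{(k)}_v=\lambda^{(k-1)}_{p(v)}\lambda_v$ for $k\ge1$. A bounded operator $T$ is hyponormal if $T^*T-TT^*\ge0$, and power hyponormal if $T^n$ is hyponormal for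 all $n\ge1$. Empty sums are $0$. (Leaflessness together with properness prevents the denominators in $\mathtt h_k$ from being zero.) *)

theory Defs
  imports "HOL-Analysis.Analysis"
begin

definition directed_forest :: "'v set \<Rightarrow> ('v \<Rightarrow> 'v) \<Rightarrow> bool" where
  "directed_forest V p \<longleftrightarrow>
     V \<noteq> {} \<and> p \<in> V \<rightarrow> V \<and> (\<forall>v\<in>V. \<forall>n\<ge>1. (p ^^ n) v = v \<longrightarrow> p v = v)"

definition roots :: "'v set \<Rightarrow> ('v \<Rightarrow> 'v) \<Rightarrow> 'v set" where
  "roots V p = {v \<in> V. p v = v}"

text \<open>Only meant for \<open>k \<ge> 1\<close>.\<close>

definition Chi :: "'v set \<Rightarrow> ('v \<Rightarrow> 'v) \<Rightarrow> nat \<Rightarrow> 'v \<Rightarrow> 'v set" where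
  "Chi V p k v = {u \<in> V. (p ^^ k) u = v \<and> (p ^^ (k - 1)) u \<noteq> v}"

definition leafless :: "'v set \<Rightarrow> ('v \<Rightarrow> 'v) \<Rightarrow> bool" where
  "leafless V p \<longleftrightarrow> p ` V = V"

text \<open>A function on \<open>V\<close> is represented by its extension by zero, so that equality of elements
  of \<open>ell2 V\<close> is equality of HOL functions.\<close>

definition ell2 :: "'v set \<Rightarrow> ('v \<Rightarrow> complex) set" where
  "ell2 V = {f. (\<forall>v. v \<notin> V \<longrightarrow> f v = 0) \<and> (\<lambda>v. (cmod (f v))\<^sup>2) summable_on V}"

definition ell2_inner :: "'v set \<Rightarrow> ('v \<Rightarrow> complex) \<Rightarrow> ('v \<Rightarrow> complex) \<Rightarrow> complex" where
  "ell2_inner V f g = (\<Sum>\<^sub>\<infinity>v\<in>V. f v * cnj (g v))"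

definition ell2_norm :: "'v set \<Rightarrow> ('v \<Rightarrow> complex) \<Rightarrow> real" where
  "ell2_norm V f = sqrt (\<Sum>\<^sub>\<infinity>v\<in>V. (cmod (f v))\<^sup>2)"

definition basis_vec :: "'v \<Rightarrow> 'v \<Rightarrow> complex" where
  "basis_vec u = (\<lambda>v. if v = u then 1 else 0)"

text \<open>Operators in \<open>ell2 V\<close> are HOL functions of which only the values on \<open>ell2 V\<close> matter.
  A bounded operator is everywhere defined on \<open>ell2 V\<close>.\<close>

definition bounded_operator ::
    "'v set \<Rightarrow> (('v \<Rightarrow> complex) \<Rightarrow> ('v \<Rightarrow> complex)) \<Rightarrow> bool" where
  "bounded_operator V T \<longleftrightarrow>
     T \<in> ell2 V \<rightarrow> ell2 V \<and>
     (\<forall>f\<in>ell2 V. \<forall>g\<in>ell2 V. T (\<lambda>v. f v + g v) = (\<lambda>v. T f v + T g v)) \<and>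
     (\<forall>c. \<forall>f\<in>ell2 V. T (\<lambda>v. c * f v) = (\<lambda>v. c * T f v)) \<and>
     (\<exists>C. \<forall>f\<in>ell2 V. ell2_norm V (T f) \<le> C * ell2_norm V f)"

text \<open>For a bounded operator \<open>T\<close> the vector described exists and is unique by the Riesz
  representation theorem.\<close>

definition adjoint_operator ::
    "'v set \<Rightarrow> (('v \<Rightarrow> complex) \<Rightarrow> ('v \<Rightarrow> complex)) \<Rightarrow> ('v \<Rightarrow> complex) \<Rightarrow> ('v \<Rightarrow> complex)" where
  "adjoint_operator V T g =
     (THE h. h \<in> ell2 V \<and> (\<forall>f\<in>ell2 V. ell2_inner V (T f) g = ell2_inner V f h))"

definition positive_operator ::
    "'v set \<Rightarrow> (('v \<Rightarrow> complex) \<Rightarrow> ('v \<Rightarrow> complex)) \<Rightarrow> bool" where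
  "positive_operator V A \<longleftrightarrow> (\<forall>f\<in>ell2 V. ell2_inner V (A f) f \<in> \<real>\<^sub>\<ge>\<^sub>0)"

definition hyponormal ::
    "'v set \<Rightarrow> (('v \<Rightarrow> complex) \<Rightarrow> ('v \<Rightarrow> complex)) \<Rightarrow> bool" where
  "hyponormal V T \<longleftrightarrow>
     bounded_operator V T \<and>
     positive_operator V
       (\<lambda>f v. adjoint_operator V T (T f) v - T (adjoint_operator V T f) v)"

definition power_hyponormal ::
    "'v set \<Rightarrow> (('v \<Rightarrow> complex) \<Rightarrow> ('v \<Rightarrow> complex)) \<Rightarrow> bool" where
  "power_hyponormal V T \<longleftrightarrow> (\<forall>n\<ge>1. hyponormal V (T ^^ n))"

definition weight_system :: "'v set \<Rightarrow> ('v \<Rightarrow> 'v) \<Rightarrow> ('v \<Rightarrow> complex) \<Rightarrow> bool" where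
  "weight_system V p l \<longleftrightarrow> (\<forall>v\<in>roots V p. l v = 0)"

definition weighted_shift ::
    "'v set \<Rightarrow> ('v \<Rightarrow> 'v) \<Rightarrow> ('v \<Rightarrow> complex) \<Rightarrow> ('v \<Rightarrow> complex) \<Rightarrow> ('v \<Rightarrow> complex)" where
  "weighted_shift V p l f = (\<lambda>v. if v \<in> V then l v * f (p v) else 0)"

definition weighted_shift_domain ::
    "'v set \<Rightarrow> ('v \<Rightarrow> 'v) \<Rightarrow> ('v \<Rightarrow> complex) \<Rightarrow> ('v \<Rightarrow> complex) set" where
  "weighted_shift_domain V p l = {f \<in> ell2 V. weighted_shift V p l f \<in> ell2 V}"

definition bounded_weighted_shift :: "'v set \<Rightarrow> ('v \<Rightarrow> 'v) \<Rightarrow> ('v \<Rightarrow> complex) \<Rightarrow> bool" where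
  "bounded_weighted_shift V p l \<longleftrightarrow>
     weighted_shift_domain V p l = ell2 V \<and> bounded_operator V (weighted_shift V p l)"

definition proper_weights :: "'v set \<Rightarrow> ('v \<Rightarrow> 'v) \<Rightarrow> ('v \<Rightarrow> complex) \<Rightarrow> bool" where
  "proper_weights V p l \<longleftrightarrow> {v \<in> V. l v = 0} = roots V p"

primrec iterated_weight :: "('v \<Rightarrow> 'v) \<Rightarrow> ('v \<Rightarrow> complex) \<Rightarrow> nat \<Rightarrow> 'v \<Rightarrow> complex" where
  "iterated_weight p l 0 v = 1"
| "iterated_weight p l (Suc k) v = iterated_weight p l k (p v) * l v"

text \<open>The index set may be infinite, so the sum is taken in \<^typ>\<open>ennreal\<close>: a divergent sum
  is \<open>\<infinity>\<close>, whereas a real-valued \<^const>\<open>infsum\<close> would silently be \<open>0\<close>.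
  The denominators are nonzero for proper weights on a leafless forest.\<close>

definition h_sum ::
    "'v set \<Rightarrow> ('v \<Rightarrow> 'v) \<Rightarrow> ('v \<Rightarrow> complex) \<Rightarrow> nat \<Rightarrow> 'v \<Rightarrow> ennreal" where
  "h_sum V p l k v =
     (\<Sum>\<^sub>\<infinity>u\<in>Chi V p k v.
        ennreal ((cmod (iterated_weight p l k u))\<^sup>2
          / (ell2_norm V ((weighted_shift V p l ^^ k) (basis_vec u)))\<^sup>2))"

end

theory Submission
  imports Defs
begin

text \<open>
  The power \<open>S^k\<close> is the weighted shift along the map \<open>p^k\<close> with weights \<open>\<lambda>^(k)\<close>, so it is enough
  to treat a bounded weighted shift \<open>T\<close> along an arbitrary self-map \<open>q\<close> of \<open>V\<close>. Here \<open>T*T\<close> is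
  multiplication by \<open>a v = \<parallel>T e_v\<parallel>\<^sup>2\<close>, while \<open>(T*f)(v)\<close> only involves the values of \<open>f\<close> on the fibre
  \<open>q\<^sup>-\<^sup>1(v)\<close>. Hyponormality \<open>\<parallel>T*f\<parallel>\<^sup>2 \<le> \<parallel>T f\<parallel>\<^sup>2\<close> therefore splits into one condition per fibre,
  \<open>\<bar>\<Sum> cnj (m u) f u\<bar>\<^sup>2 \<le> \<Sum> a u \<bar>f u\<bar>\<^sup>2\<close>, which by the Cauchy-Schwarz inequality (sharp at
  \<open>f u = m u / a u\<close>) means that \<open>\<Sum> \<bar>m u\<bar>\<^sup>2 / a u \<le> 1\<close> and that \<open>m u = 0\<close> whenever \<open>a u = 0\<close>. For the
  powers of \<open>S\<close>, the latter requirement is leaflessness.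
\<close>

section \<open>Square-summable functions\<close>

text \<open>The finite Cauchy-Schwarz inequality bounds all finite partial sums uniformly, which
  gives summability and passes to the limit. The majorant is a free product \<open>x u * y u\<close>
  so that one estimate serves inner products, \<open>adj\<close>, and the rescaling by
  \<open>sqrt (a u)\<close> in \<open>hyponormalI\<close>.\<close>

lemma infsum_Cauchy_Schwarz:
  fixes c :: "'a \<Rightarrow> complex" and x y :: "'a \<Rightarrow> real"
  assumes x: "(\<lambda>u. (x u)\<^sup>2) summable_on A" and y: "(\<lambda>u. (y u)\<^sup>2) summable_on A"
    and le: "\<And>u. u \<in> A \<Longrightarrow> cmod (c u) \<le> x u * y u"
  shows "(\<lambda>u. cmod (c u)) summable_on A"
    and "(cmod (infsum c A))\<^sup>2 \<le> (\<Sum>\<^sub>\<infinity>u\<in>A. (x u)\<^sup>2) * (\<Sum>\<^sub>\<infinity>u\<in>A. (y u)\<^sup>2)"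
proof -
  let ?X = "\<Sum>\<^sub>\<infinity>u\<in>A. (x u)\<^sup>2" and ?Y = "\<Sum>\<^sub>\<infinity>u\<in>A. (y u)\<^sup>2"
  have fin: "(\<Sum>u\<in>F. cmod (c u)) \<le> sqrt (?X * ?Y)" if "finite F" "F \<subseteq> A" for F
  proof -
    have "(\<Sum>u\<in>F. cmod (c u))\<^sup>2 \<le> (\<Sum>u\<in>F. x u * y u)\<^sup>2"
      using le that by (intro power_mono sum_mono sum_nonneg) auto
    also have "\<dots> \<le> (\<Sum>u\<in>F. (x u)\<^sup>2) * (\<Sum>u\<in>F. (y u)\<^sup>2)"
      by (rule Cauchy_Schwarz_ineq_sum)
    also have "\<dots> \<le> ?X * ?Y"
      using that x y by (intro mult_mono finite_sum_le_infsum sum_nonneg infsum_nonneg) auto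
    finally show ?thesis
      by (rule real_le_rsqrt)
  qed
  show abs: "(\<lambda>u. cmod (c u)) summable_on A"
    by (rule nonneg_bdd_above_summable_on) (use fin in \<open>auto intro!: bdd_aboveI2\<close>)
  have "cmod (infsum c A) \<le> (\<Sum>\<^sub>\<infinity>u\<in>A. cmod (c u))"
    using abs by (rule norm_infsum_bound)
  also have "\<dots> \<le> sqrt (?X * ?Y)"
    using abs fin by (rule infsum_le_finite_sums)
  finally have "(cmod (infsum c A))\<^sup>2 \<le> (sqrt (?X * ?Y))\<^sup>2"
    by (intro power_mono) auto
  then show "(cmod (infsum c A))\<^sup>2 \<le> ?X * ?Y"
    by (simp add: infsum_nonneg)
qed

text \<open>The fibres over \<open>W\<close> partition \<open>V\<close>, and an unconditionally
  convergent series in a Banach space may be grouped along a partition. Every later reduction to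
  single fibres rests on this.\<close>

lemma has_sum_fibres:
  fixes g :: "'a \<Rightarrow> 'b::banach"
  assumes q: "q \<in> V \<rightarrow> W" and g: "(g has_sum s) V"
  shows "((\<lambda>v. infsum g {u \<in> V. q u = v}) has_sum s) W"
proof -
  let ?B = "\<lambda>v. {u \<in> V. q u = v}"
  have bij: "bij_betw snd (Sigma W ?B) V"
    by (rule bij_betwI[where g = "\<lambda>u. (q u, u)"]) (use q in auto)
  have "((\<lambda>z. g (snd z)) has_sum s) (Sigma W ?B)"
    using g by (simp add: has_sum_reindex_bij_betw[OF bij])
  then show ?thesis
  proof (rule has_sum_SigmaD)
    fix v assume "v \<in> W"
    have "g summable_on ?B v"
      using g summable_on_subset_banach[of g V "?B v"] by (auto simp: summable_on_def)
    then show "((\<lambda>u. g (snd (v, u))) has_sum infsum g (?B v)) (?B v)"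
      by simp
  qed
qed

section \<open>Vectors, norms and inner products in \<open>ell2\<close>\<close>

lemma ell2_outside: "f \<in> ell2 V \<Longrightarrow> v \<notin> V \<Longrightarrow> f v = 0"
  by (simp add: ell2_def)

lemma ell2_summable: "f \<in> ell2 V \<Longrightarrow> (\<lambda>v. (cmod (f v))\<^sup>2) summable_on V"
  by (simp add: ell2_def)

lemma ell2_finite_support:
  assumes "finite F" "F \<subseteq> V"
  shows "(\<lambda>v. if v \<in> F then f v else 0) \<in> ell2 V"
proof -
  have "(\<lambda>v. (cmod (f v))\<^sup>2) summable_on F"
    using assms by simp
  then have "(\<lambda>v. (cmod (if v \<in> F then f v else 0))\<^sup>2) summable_on V"
    by (rule summable_on_cong_neutral[THEN iffD1, rotated -1]) (use assms in auto)
  then show ?thesis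
    using assms by (auto simp: ell2_def)
qed

lemma basis_vec_in_ell2: "u \<in> V \<Longrightarrow> basis_vec u \<in> ell2 V"
  using ell2_finite_support[of "{u}" V "\<lambda>_. 1"] by (simp add: basis_vec_def)

lemma ell2_norm_power2: "(ell2_norm V f)\<^sup>2 = (\<Sum>\<^sub>\<infinity>v\<in>V. (cmod (f v))\<^sup>2)"
  by (simp add: ell2_norm_def infsum_nonneg)

lemma ell2_norm_nonneg: "0 \<le> ell2_norm V f"
  by (simp add: ell2_norm_def infsum_nonneg)

lemma infsum_single:
  fixes g :: "'a \<Rightarrow> 'b::{comm_monoid_add, t2_space}"
  assumes "u \<in> A" "\<And>v. v \<in> A \<Longrightarrow> v \<noteq> u \<Longrightarrow> g v = 0"
  shows "infsum g A = g u"
proof -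
  have "infsum g A = infsum g {u}"
    by (rule infsum_cong_neutral) (use assms in auto)
  then show ?thesis by simp
qed

lemma ell2_norm_basis_vec: "u \<in> V \<Longrightarrow> ell2_norm V (basis_vec u) = 1"
  by (simp add: ell2_norm_def infsum_single[of u] basis_vec_def)

lemma ell2_inner_basis_vec: "u \<in> V \<Longrightarrow> ell2_inner V (basis_vec u) g = cnj (g u)"
  unfolding ell2_inner_def by (subst infsum_single[of u]) (auto simp: basis_vec_def)

lemma ell2_mult_summable:
  assumes "f \<in> ell2 V" "g \<in> ell2 V"
  shows "(\<lambda>v. f v * cnj (g v)) summable_on V"
  by (rule abs_summable_summable,
      rule infsum_Cauchy_Schwarz(1)[of "\<lambda>v. cmod (f v)" _ "\<lambda>v. cmod (g v)"])
     (use assms in \<open>auto simp: norm_mult ell2_summable\<close>)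

lemma ell2_inner_diff_left:
  assumes "f \<in> ell2 V" "g \<in> ell2 V" "h \<in> ell2 V"
  shows "ell2_inner V (\<lambda>v. f v - g v) h = ell2_inner V f h - ell2_inner V g h"
proof -
  have "((\<lambda>v. f v * cnj (h v) - g v * cnj (h v)) has_sum
      (ell2_inner V f h - ell2_inner V g h)) V"
    unfolding ell2_inner_def diff_conv_add_uminus using assms
    by (intro has_sum_add has_sum_uminusI has_sum_infsum ell2_mult_summable)
  then show ?thesis
    unfolding ell2_inner_def by (auto intro!: infsumI simp: left_diff_distrib)
qed

lemma ell2_inner_self:
  assumes "f \<in> ell2 V"
  shows "ell2_inner V f f = of_real ((ell2_norm V f)\<^sup>2)"
proof -
  have "((\<lambda>v. complex_of_real ((cmod (f v))\<^sup>2)) has_sum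
      complex_of_real (\<Sum>\<^sub>\<infinity>v\<in>V. (cmod (f v))\<^sup>2)) V"
    using assms by (intro has_sum_of_real has_sum_infsum ell2_summable)
  then show ?thesis
    unfolding ell2_inner_def ell2_norm_power2
    by (auto intro!: infsumI simp: complex_norm_square[symmetric])
qed

section \<open>Adjoints and composition of bounded operators\<close>

lemma adjoint_operator_eqI:
  assumes "h \<in> ell2 V" and "\<And>f. f \<in> ell2 V \<Longrightarrow> ell2_inner V (T f) g = ell2_inner V f h"
  shows "adjoint_operator V T g = h"
  unfolding adjoint_operator_def
proof (rule the_equality)
  fix h' assume h': "h' \<in> ell2 V \<and> (\<forall>f\<in>ell2 V. ell2_inner V (T f) g = ell2_inner V f h')"
  show "h' = h"
  proof
    \<comment> \<open>Inside \<open>V\<close>, pairing with \<open>basis_vec v\<close> reads off the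
      value at \<open>v\<close>; outside \<open>V\<close>, both vectors vanish by the encoding of
      \<open>ell2\<close>.\<close>
    fix v
    show "h' v = h v"
    proof (cases "v \<in> V")
      case True
      then have "cnj (h' v) = cnj (h v)"
        using assms h' basis_vec_in_ell2[OF True] by (metis ell2_inner_basis_vec)
      then show ?thesis by simp
    next
      case False
      then show ?thesis using assms(1) h' ell2_outside[of _ V v] by metis
    qed
  qed
qed (use assms in auto)

lemma bounded_operator_compose:
  assumes "bounded_operator V S" "bounded_operator V T"
  shows "bounded_operator V (S \<circ> T)"
proof -
  obtain C D where C: "\<forall>f\<in>ell2 V. ell2_norm V (S f) \<le> C * ell2_norm V f"
    and D: "\<forall>f\<in>ell2 V. ell2_norm V (T f) \<le> D * ell2_norm V f"
    using assms unfolding bounded_operator_def by blast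
  have S: "\<And>f. f \<in> ell2 V \<Longrightarrow> S f \<in> ell2 V" and T: "\<And>f. f \<in> ell2 V \<Longrightarrow> T f \<in> ell2 V"
    using assms unfolding bounded_operator_def by auto
  \<comment> \<open>The sign of \<open>C\<close> is unknown, and inserting the bound for
    \<open>T\<close> needs a nonnegative factor, hence \<open>\<bar>C\<bar>\<close>.\<close>
  have "ell2_norm V (S (T f)) \<le> (\<bar>C\<bar> * D) * ell2_norm V f" if "f \<in> ell2 V" for f
  proof -
    have "ell2_norm V (S (T f)) \<le> C * ell2_norm V (T f)"
      using C T that by blast
    also have "\<dots> \<le> \<bar>C\<bar> * ell2_norm V (T f)"
      by (intro mult_right_mono ell2_norm_nonneg) auto
    also have "\<dots> \<le> \<bar>C\<bar> * (D * ell2_norm V f)"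
      using D that by (intro mult_left_mono) auto
    finally show ?thesis by (simp add: mult.assoc)
  qed
  then show ?thesis
    using assms S T unfolding bounded_operator_def by (auto simp: Pi_iff)
qed

section \<open>Hyponormality of a weighted shift along a self-map\<close>

locale bounded_shift =
  fixes V :: "'v set" and q :: "'v \<Rightarrow> 'v" and m :: "'v \<Rightarrow> complex"
  assumes q_in: "q \<in> V \<rightarrow> V"
    and bounded: "bounded_operator V (weighted_shift V q m)"
begin

abbreviation T :: "('v \<Rightarrow> complex) \<Rightarrow> 'v \<Rightarrow> complex" where
  "T \<equiv> weighted_shift V q m"

definition fibre :: "'v \<Rightarrow> 'v set" where
  "fibre v = {u \<in> V. q u = v}"

definition a :: "'v \<Rightarrow> real" where
  "a v = (ell2_norm V (T (basis_vec v)))\<^sup>2"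

text \<open>An explicit candidate for the adjoint of \<open>T\<close>; \<open>adjoint_eq_adj\<close>
  uses it to eliminate the definite description. The value 0 outside \<open>V\<close> is forced by
  the encoding of \<open>ell2\<close>.\<close>

definition adj :: "('v \<Rightarrow> complex) \<Rightarrow> 'v \<Rightarrow> complex" where
  "adj f v = (if v \<in> V then \<Sum>\<^sub>\<infinity>u\<in>fibre v. cnj (m u) * f u else 0)"

lemma fibre_subset: "fibre v \<subseteq> V"
  by (auto simp: fibre_def)

lemma has_sum_fibre: "(g has_sum s) V \<Longrightarrow> ((\<lambda>v. infsum g (fibre v)) has_sum s) V"
  for g :: "'v \<Rightarrow> 'b::banach"
  using has_sum_fibres[OF q_in] by (simp add: fibre_def)

lemma T_in_ell2: "f \<in> ell2 V \<Longrightarrow> T f \<in> ell2 V"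
  using bounded by (auto simp: bounded_operator_def)

lemma a_nonneg: "0 \<le> a v"
  by (simp add: a_def)

text \<open>The operator bound is tested on unit vectors. The uniform bound is what makes
  \<open>adj f\<close> square-summable.\<close>

lemma a_bounded: obtains C where "0 \<le> C" "\<And>v. v \<in> V \<Longrightarrow> a v \<le> C"
proof -
  obtain C where C: "\<forall>f\<in>ell2 V. ell2_norm V (T f) \<le> C * ell2_norm V f"
    using bounded by (auto simp: bounded_operator_def)
  have "a v \<le> C\<^sup>2" if "v \<in> V" for v
    using C basis_vec_in_ell2[OF that] ell2_norm_basis_vec[OF that]
    unfolding a_def by (intro power_mono ell2_norm_nonneg) force
  then show ?thesis using that[of "C\<^sup>2"] by auto
qed

text \<open>\<open>T (basis_vec v)\<close> agrees with \<open>m\<close> on the fibre of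
  \<open>v\<close> and vanishes elsewhere.\<close>

lemma has_sum_weights_fibre:
  assumes "v \<in> V"
  shows "((\<lambda>u. (cmod (m u))\<^sup>2) has_sum a v) (fibre v)"
proof -
  have "((\<lambda>u. (cmod (T (basis_vec v) u))\<^sup>2) has_sum a v) V"
    unfolding a_def ell2_norm_power2
    using assms by (intro has_sum_infsum ell2_summable T_in_ell2 basis_vec_in_ell2)
  then show ?thesis
    by (rule has_sum_cong_neutral[THEN iffD1, rotated -1])
       (auto simp: fibre_def weighted_shift_def basis_vec_def)
qed

lemma weight_le_a: "u \<in> V \<Longrightarrow> (cmod (m u))\<^sup>2 \<le> a (q u)"
  using finite_sum_le_has_sum[OF has_sum_weights_fibre[of "q u"], of "{u}"] q_in
  by (auto simp: fibre_def)

section \<open>The explicit adjoint and the diagonal form of T*T\<close>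

lemma summable_on_fibre:
  "f \<in> ell2 V \<Longrightarrow> (\<lambda>u. (cmod (f u))\<^sup>2) summable_on fibre v"
  using ell2_summable fibre_subset by (rule summable_on_subset_banach)

lemma adj_norm_le:
  assumes "f \<in> ell2 V" "v \<in> V"
  shows "(cmod (adj f v))\<^sup>2 \<le> a v * (\<Sum>\<^sub>\<infinity>u\<in>fibre v. (cmod (f u))\<^sup>2)"
proof -
  have "(\<lambda>u. (cmod (m u))\<^sup>2) summable_on fibre v"
    using has_sum_weights_fibre[OF assms(2)] by (auto simp: summable_on_def)
  from infsum_Cauchy_Schwarz(2)[OF this summable_on_fibre[OF assms(1)],
      of "\<lambda>u. cnj (m u) * f u"]
  show ?thesis
    using assms infsumI[OF has_sum_weights_fibre[OF assms(2)]]
    by (simp add: adj_def norm_mult)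
qed

lemma adj_in_ell2:
  assumes "f \<in> ell2 V"
  shows "adj f \<in> ell2 V"
proof -
  obtain C where C: "0 \<le> C" "\<And>v. v \<in> V \<Longrightarrow> a v \<le> C"
    using a_bounded by blast
  have "(\<lambda>v. \<Sum>\<^sub>\<infinity>u\<in>fibre v. (cmod (f u))\<^sup>2) summable_on V"
    using has_sum_fibre[OF has_sum_infsum[OF ell2_summable[OF assms]]]
    by (auto simp: summable_on_def)
  then have "(\<lambda>v. C * (\<Sum>\<^sub>\<infinity>u\<in>fibre v. (cmod (f u))\<^sup>2)) summable_on V"
    by (rule summable_on_cmult_right)
  then have "(\<lambda>v. (cmod (adj f v))\<^sup>2) summable_on V"
  proof (rule summable_on_comparison_test)
    fix v assume "v \<in> V"
    have "(cmod (adj f v))\<^sup>2 \<le> a v * (\<Sum>\<^sub>\<infinity>u\<in>fibre v. (cmod (f u))\<^sup>2)"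
      using adj_norm_le[OF assms \<open>v \<in> V\<close>] .
    also have "\<dots> \<le> C * (\<Sum>\<^sub>\<infinity>u\<in>fibre v. (cmod (f u))\<^sup>2)"
      using C \<open>v \<in> V\<close> by (intro mult_right_mono infsum_nonneg) auto
    finally show "(cmod (adj f v))\<^sup>2 \<le> C * (\<Sum>\<^sub>\<infinity>u\<in>fibre v. (cmod (f u))\<^sup>2)" .
  qed auto
  then show ?thesis by (auto simp: ell2_def adj_def)
qed

text \<open>Group the inner product by fibres: on the fibre of \<open>v\<close> the factor
  \<open>f (q u)\<close> is the constant \<open>f v\<close> and can be pulled out, leaving the
  conjugate of \<open>adj g v\<close>.\<close>

lemma inner_T_left:
  assumes f: "f \<in> ell2 V" and g: "g \<in> ell2 V"
  shows "ell2_inner V (T f) g = ell2_inner V f (adj g)"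
proof -
  have "((\<lambda>u. T f u * cnj (g u)) has_sum ell2_inner V (T f) g) V"
    unfolding ell2_inner_def
    using assms by (intro has_sum_infsum ell2_mult_summable T_in_ell2)
  from has_sum_fibre[OF this]
  have "((\<lambda>v. \<Sum>\<^sub>\<infinity>u\<in>fibre v. T f u * cnj (g u)) has_sum ell2_inner V (T f) g) V" .
  moreover have "(\<Sum>\<^sub>\<infinity>u\<in>fibre v. T f u * cnj (g u)) = f v * cnj (adj g v)" if "v \<in> V" for v
  proof -
    have "(\<Sum>\<^sub>\<infinity>u\<in>fibre v. T f u * cnj (g u)) = (\<Sum>\<^sub>\<infinity>u\<in>fibre v. f v * cnj (cnj (m u) * g u))"
      by (rule infsum_cong) (auto simp: weighted_shift_def fibre_def)
    also have "\<dots> = f v * (\<Sum>\<^sub>\<infinity>u\<in>fibre v. cnj (cnj (m u) * g u))"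
      by (rule infsum_cmult_right')
    also have "\<dots> = f v * cnj (adj g v)"
      using that by (simp add: adj_def infsum_cnj[symmetric] del: infsum_cnj)
    finally show ?thesis .
  qed
  ultimately have "((\<lambda>v. f v * cnj (adj g v)) has_sum ell2_inner V (T f) g) V"
    by (simp cong: has_sum_cong)
  then show ?thesis
    by (simp add: ell2_inner_def[of V f] infsumI)
qed

lemma adjoint_eq_adj: "g \<in> ell2 V \<Longrightarrow> adjoint_operator V T g = adj g"
  by (rule adjoint_operator_eqI) (auto simp: adj_in_ell2 inner_T_left)

text \<open>On the fibre of \<open>v\<close>, \<open>T f u\<close> is \<open>m u * f v\<close>, so
  the weights enter only through their squared moduli, whose sum is \<open>a v\<close>.\<close>

lemma adj_T:
  assumes "f \<in> ell2 V"
  shows "adj (T f) = (\<lambda>v. of_real (a v) * f v)"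
proof
  fix v
  show "adj (T f) v = of_real (a v) * f v"
  proof (cases "v \<in> V")
    case True
    have "((\<lambda>u. complex_of_real ((cmod (m u))\<^sup>2) * f v) has_sum (of_real (a v) * f v)) (fibre v)"
      by (intro has_sum_cmult_left has_sum_of_real has_sum_weights_fibre True)
    moreover have "complex_of_real ((cmod (m u))\<^sup>2) * f v = cnj (m u) * T f u" if "u \<in> fibre v" for u
      using that unfolding complex_norm_square by (auto simp: weighted_shift_def fibre_def)
    ultimately have "((\<lambda>u. cnj (m u) * T f u) has_sum (of_real (a v) * f v)) (fibre v)"
      by (simp cong: has_sum_cong)
    then show ?thesis using True by (simp add: adj_def infsumI)
  qed (use assms in \<open>simp add: adj_def ell2_outside\<close>)
qed

text \<open>The squared norm is the inner product of \<open>f\<close> with T*T f, and T*T is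
  diagonal by \<open>adj_T\<close>.\<close>

lemma has_sum_norm_T:
  assumes "f \<in> ell2 V"
  shows "((\<lambda>v. a v * (cmod (f v))\<^sup>2) has_sum (ell2_norm V (T f))\<^sup>2) V"
proof -
  have "ell2_inner V (T f) (T f) = ell2_inner V f (adj (T f))"
    using assms by (simp add: inner_T_left T_in_ell2)
  moreover have "((\<lambda>v. f v * cnj (adj (T f) v)) has_sum ell2_inner V f (adj (T f))) V"
    unfolding ell2_inner_def
    using assms by (intro has_sum_infsum ell2_mult_summable adj_in_ell2 T_in_ell2)
  moreover have "f v * cnj (adj (T f) v) = complex_of_real (a v * (cmod (f v))\<^sup>2)" for v
    using assms by (simp add: adj_T complex_norm_square del: of_real_power)
  ultimately have "((\<lambda>v. complex_of_real (a v * (cmod (f v))\<^sup>2)) has_sum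
      complex_of_real ((ell2_norm V (T f))\<^sup>2)) V"
    using assms by (simp add: ell2_inner_self T_in_ell2)
  then show ?thesis
    by (auto dest: has_sum_Re)
qed

section \<open>Hyponormality as a condition on each fibre\<close>

lemma hyponormal_iff_norm_le:
  "hyponormal V T \<longleftrightarrow>
     (\<forall>f\<in>ell2 V. (ell2_norm V (adj f))\<^sup>2 \<le> (ell2_norm V (T f))\<^sup>2)"
proof -
  \<comment> \<open>The quadratic form of T*T - TT* is a difference of squared norms. It is real, so
    positivity becomes a plain inequality.\<close>
  have "ell2_inner V
      (\<lambda>v. adjoint_operator V T (T f) v - T (adjoint_operator V T f) v) f =
      of_real ((ell2_norm V (T f))\<^sup>2 - (ell2_norm V (adj f))\<^sup>2)" if f: "f \<in> ell2 V" for f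
  proof -
    have "ell2_inner V (adj (T f)) f = cnj (ell2_inner V f (adj (T f)))"
      unfolding ell2_inner_def infsum_cnj[symmetric] by (simp add: mult.commute)
    also have "\<dots> = of_real ((ell2_norm V (T f))\<^sup>2)"
      using f by (simp add: inner_T_left[symmetric] T_in_ell2 ell2_inner_self)
    finally show ?thesis
      using f by (simp add: adjoint_eq_adj ell2_inner_diff_left adj_in_ell2 T_in_ell2
          inner_T_left ell2_inner_self)
  qed
  then show ?thesis
    using bounded unfolding hyponormal_def positive_operator_def
    by (simp only: nonneg_Reals_of_real_iff diff_ge_0_iff_ge simp_thms cong: ball_cong)
qed

text \<open>Test with the basis vector at \<open>u\<close>: its image under the adjoint has the
  entry \<open>cnj (m u)\<close> at \<open>q u\<close>, while its image under \<open>T\<close> has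
  squared norm \<open>a u\<close>.\<close>

lemma hyponormal_imp_a_nonzero:
  assumes hyp: "hyponormal V T" and u: "u \<in> V" "a u = 0"
  shows "m u = 0"
proof -
  have e: "basis_vec u \<in> ell2 V"
    using u(1) by (rule basis_vec_in_ell2)
  have qu: "q u \<in> V"
    using q_in u by auto
  have "adj (basis_vec u) (q u) = cnj (m u)"
    unfolding adj_def using u qu
    by (subst infsum_single[of u]) (auto simp: basis_vec_def fibre_def)
  moreover have "(cmod (adj (basis_vec u) (q u)))\<^sup>2 \<le> (ell2_norm V (adj (basis_vec u)))\<^sup>2"
    using finite_sum_le_infsum[OF ell2_summable[OF adj_in_ell2[OF e]], of "{q u}"] qu
    by (simp add: ell2_norm_power2)
  moreover have "(ell2_norm V (adj (basis_vec u)))\<^sup>2 \<le> a u"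
    using hyp e unfolding hyponormal_iff_norm_le a_def by blast
  ultimately show ?thesis using u by simp
qed

lemma hyponormal_imp_sum_le:
  assumes hyp: "hyponormal V T" and v: "v \<in> V" and F: "finite F" "F \<subseteq> fibre v"
  shows "(\<Sum>u\<in>F. (cmod (m u))\<^sup>2 / a u) \<le> 1"
proof -
  define s where "s = (\<Sum>u\<in>F. (cmod (m u))\<^sup>2 / a u)"
  \<comment> \<open>The equality case of Cauchy-Schwarz, cut off to \<open>F\<close> so that it lies
    in \<open>ell2\<close>. Where \<open>a u = 0\<close>, division by zero makes both
    \<open>f u\<close> and the summand of \<open>s\<close> equal to 0, so the identities below still
    hold.\<close>
  define f where "f = (\<lambda>u. if u \<in> F then m u / of_real (a u) else 0)"
  have FV: "F \<subseteq> V"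
    using F fibre_subset by blast
  have f: "f \<in> ell2 V"
    unfolding f_def using F(1) FV by (rule ell2_finite_support)
  have "(\<Sum>\<^sub>\<infinity>u\<in>fibre v. cnj (m u) * f u) = (\<Sum>\<^sub>\<infinity>u\<in>F. cnj (m u) * f u)"
    by (rule infsum_cong_neutral) (use F in \<open>auto simp: f_def\<close>)
  also have "\<dots> = (\<Sum>u\<in>F. cnj (m u) * f u)"
    using F by simp
  also have "\<dots> = (\<Sum>u\<in>F. complex_of_real ((cmod (m u))\<^sup>2 / a u))"
    by (rule sum.cong) (auto simp: f_def complex_norm_square mult.commute simp del: of_real_power)
  finally have adj: "adj f v = of_real s"
    using v by (simp add: adj_def s_def)
  have "(ell2_norm V (T f))\<^sup>2 = (\<Sum>\<^sub>\<infinity>u\<in>V. a u * (cmod (f u))\<^sup>2)"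
    using has_sum_norm_T[OF f] by (simp add: infsumI)
  also have "\<dots> = (\<Sum>\<^sub>\<infinity>u\<in>F. a u * (cmod (f u))\<^sup>2)"
    by (rule infsum_cong_neutral) (use FV in \<open>auto simp: f_def\<close>)
  also have "\<dots> = (\<Sum>u\<in>F. a u * (cmod (f u))\<^sup>2)"
    using F by simp
  also have "\<dots> = s"
    unfolding s_def
    by (rule sum.cong) (auto simp: f_def norm_divide power_divide power2_eq_square)
  finally have T: "(ell2_norm V (T f))\<^sup>2 = s" .
  have "s\<^sup>2 = (cmod (adj f v))\<^sup>2"
    by (simp add: adj)
  also have "\<dots> \<le> (ell2_norm V (adj f))\<^sup>2"
    using finite_sum_le_infsum[OF ell2_summable[OF adj_in_ell2[OF f]], of "{v}"] v
    by (simp add: ell2_norm_power2)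
  also have "\<dots> \<le> s"
    using hyp f T unfolding hyponormal_iff_norm_le by metis
  finally have "s * s \<le> s * 1"
    by (simp add: power2_eq_square)
  \<comment> \<open>A positive \<open>s\<close> cancels; otherwise the bound is immediate.\<close>
  then have "s \<le> 1"
    by (cases "s > 0") (auto simp: mult_le_cancel_left)
  then show ?thesis by (simp add: s_def)
qed

text \<open>Both squared norms are sums over \<open>V\<close>, the one of \<open>T f\<close> after
  grouping by fibres, so it suffices to compare them at each \<open>v\<close>.\<close>

lemma hyponormalI:
  assumes nz: "\<And>u. u \<in> V \<Longrightarrow> a u = 0 \<Longrightarrow> m u = 0"
    and le: "\<And>v F. v \<in> V \<Longrightarrow> finite F \<Longrightarrow> F \<subseteq> fibre v \<Longrightarrow> (\<Sum>u\<in>F. (cmod (m u))\<^sup>2 / a u) \<le> 1"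
  shows "hyponormal V T"
  unfolding hyponormal_iff_norm_le
proof
  fix f assume f: "f \<in> ell2 V"
  let ?g = "\<lambda>u. a u * (cmod (f u))\<^sup>2"
  have g: "?g summable_on V"
    using has_sum_norm_T[OF f] by (auto simp: summable_on_def)
  have gv: "((\<lambda>v. infsum ?g (fibre v)) has_sum (ell2_norm V (T f))\<^sup>2) V"
    using has_sum_norm_T[OF f] by (rule has_sum_fibre)
  have "(cmod (adj f v))\<^sup>2 \<le> infsum ?g (fibre v)" if v: "v \<in> V" for v
  proof -
    let ?b = "\<lambda>u. (cmod (m u))\<^sup>2 / a u"
    have b: "?b summable_on fibre v"
      by (rule nonneg_bdd_above_summable_on)
         (use le[OF v] in \<open>auto intro!: bdd_aboveI2 simp: a_nonneg\<close>)
    have b1: "infsum ?b (fibre v) \<le> 1"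
      using b le[OF v] by (rule infsum_le_finite_sums)
    have sq: "(cmod (m u) / sqrt (a u))\<^sup>2 = ?b u" "(sqrt (a u) * cmod (f u))\<^sup>2 = ?g u" for u
      by (simp_all add: power_divide power_mult_distrib a_nonneg)
    have "(cmod (\<Sum>\<^sub>\<infinity>u\<in>fibre v. cnj (m u) * f u))\<^sup>2 \<le> infsum ?b (fibre v) * infsum ?g (fibre v)"
      unfolding sq[symmetric]
    proof (rule infsum_Cauchy_Schwarz(2))
      show "(\<lambda>u. (cmod (m u) / sqrt (a u))\<^sup>2) summable_on fibre v"
        using b by (simp add: sq)
      show "(\<lambda>u. (sqrt (a u) * cmod (f u))\<^sup>2) summable_on fibre v"
        using summable_on_subset_banach[OF g fibre_subset] by (simp add: sq)
      \<comment> \<open>The factors \<open>sqrt (a u)\<close> cancel unless \<open>a u = 0\<close>;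
        in that case the right side is 0, and \<open>nz\<close> makes the left side 0 too.\<close>
      fix u assume "u \<in> fibre v"
      then show "cmod (cnj (m u) * f u) \<le> cmod (m u) / sqrt (a u) * (sqrt (a u) * cmod (f u))"
        using nz[of u] by (cases "a u = 0") (auto simp: norm_mult fibre_def)
    qed
    also have "\<dots> \<le> 1 * infsum ?g (fibre v)"
      using b1 by (intro mult_right_mono infsum_nonneg) (auto simp: a_nonneg)
    finally show ?thesis using v by (simp add: adj_def)
  qed
  with has_sum_infsum[OF ell2_summable[OF adj_in_ell2[OF f]]] gv
  show "(ell2_norm V (adj f))\<^sup>2 \<le> (ell2_norm V (T f))\<^sup>2"
    unfolding ell2_norm_power2[of V "adj f"] by (rule has_sum_mono)
qed

end

section \<open>Powers of weighted shifts on directed forests\<close>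

lemma funpow_in: "p \<in> V \<rightarrow> V \<Longrightarrow> v \<in> V \<Longrightarrow> (p ^^ n) v \<in> V"
  by (induction n) auto

text \<open>For \<open>k = 0\<close> the two sides differ outside \<open>V\<close>.\<close>

lemma weighted_shift_power:
  assumes "p \<in> V \<rightarrow> V" "k \<ge> 1"
  shows "weighted_shift V p l ^^ k = weighted_shift V (p ^^ k) (iterated_weight p l k)"
  using assms(2)
proof (induction k rule: dec_induct)
  case base
  then show ?case by (simp add: weighted_shift_def fun_eq_iff)
next
  case (step n)
  show ?case
  proof (intro ext)
    fix f v
    show "(weighted_shift V p l ^^ Suc n) f v =
        weighted_shift V (p ^^ Suc n) (iterated_weight p l (Suc n)) f v"
      unfolding funpow.simps(2)[of n "weighted_shift V p l"] o_apply step.IH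
      using assms(1) by (auto simp: weighted_shift_def funpow_swap1)
  qed
qed

lemma bounded_operator_power:
  assumes "bounded_operator V S" "k \<ge> 1"
  shows "bounded_operator V (S ^^ k)"
  using assms(2)
proof (induction k rule: dec_induct)
  case base
  then show ?case using assms(1) by (simp add: comp_def)
next
  case (step n)
  show ?case
    unfolding funpow.simps(2) by (rule bounded_operator_compose[OF assms(1) step.IH])
qed

section \<open>Zeros of iterated weights, and descendants in leafless forests\<close>

lemma funpow_root: "p v = v \<Longrightarrow> (p ^^ n) v = v"
  by (induction n) auto

text \<open>The iterated weight is the product of the weights at \<open>u\<close>,
  \<open>p u\<close>, ..., \<open>(p ^^ k) u\<close>. A path that meets a root stays there, so only
  the last of these points matters.\<close>

lemma iterated_weight_nonzero_iff:
  assumes "p \<in> V \<rightarrow> V" "\<And>v. v \<in> V \<Longrightarrow> l v = 0 \<longleftrightarrow> p v = v" "u \<in> V"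
  shows "iterated_weight p l (Suc k) u \<noteq> 0 \<longleftrightarrow> p ((p ^^ k) u) \<noteq> (p ^^ k) u"
  using assms(3)
proof (induction k arbitrary: u)
  case 0
  then show ?case using assms(2) by simp
next
  case (Suc k)
  have "iterated_weight p l (Suc k) (p u) \<noteq> 0 \<longleftrightarrow> p ((p ^^ k) (p u)) \<noteq> (p ^^ k) (p u)"
    using Suc assms(1) by auto
  moreover have "p u \<noteq> u" if "p ((p ^^ k) (p u)) \<noteq> (p ^^ k) (p u)"
    using that funpow_root[of p u k] by metis
  ultimately show ?case
    using Suc.prems assms(2)[of u]
    unfolding iterated_weight.simps(2)[of _ _ "Suc k"] funpow_Suc_right o_apply by auto
qed

lemma leafless_funpow:
  assumes "leafless V p" "v \<in> V"
  shows "\<exists>u\<in>V. (p ^^ n) u = v"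
  using assms(2)
proof (induction n arbitrary: v)
  case (Suc n)
  obtain w where "w \<in> V" "p w = v"
    using assms(1) Suc.prems unfolding leafless_def by (metis imageE)
  then show ?case using Suc.IH[of w] by auto
qed auto

theorem corollary4p2:
  fixes V :: "'v set" and p :: "'v \<Rightarrow> 'v" and l :: "'v \<Rightarrow> complex"
  assumes "directed_forest V p"
    and "weight_system V p l"
    and "bounded_weighted_shift V p l"
    and "proper_weights V p l"
  shows "power_hyponormal V (weighted_shift V p l) \<longleftrightarrow>
           leafless V p \<and> (\<forall>v\<in>V. \<forall>k\<ge>1. h_sum V p l k v \<le> 1)"
proof -
  let ?S = "weighted_shift V p l"
  let ?m = "iterated_weight p l"
  have p: "p \<in> V \<rightarrow> V"
    using assms(1) by (simp add: directed_forest_def)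
  have l: "l v = 0 \<longleftrightarrow> p v = v" if "v \<in> V" for v
    using assms(4) that unfolding proper_weights_def roots_def by blast
  have bS: "bounded_operator V ?S"
    using assms(3) by (simp add: bounded_weighted_shift_def)
  have shift: "bounded_shift V (p ^^ k) (?m k)" if "k \<ge> 1" for k
  proof
    show "p ^^ k \<in> V \<rightarrow> V"
      using funpow_in[OF p] by auto
    show "bounded_operator V (weighted_shift V (p ^^ k) (?m k))"
      using bounded_operator_power[OF bS that] weighted_shift_power[OF p that] by metis
  qed
  let ?fib = "\<lambda>k. bounded_shift.fibre V (p ^^ k)"
  let ?a = "\<lambda>k. bounded_shift.a V (p ^^ k) (?m k)"
  have fib: "?fib k v = {u \<in> V. (p ^^ k) u = v}" if "k \<ge> 1" for k v
    using bounded_shift.fibre_def[OF shift[OF that]] .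
  have a: "?a k v = (ell2_norm V ((?S ^^ k) (basis_vec v)))\<^sup>2" if "k \<ge> 1" for k v
    using bounded_shift.a_def[OF shift[OF that]] weighted_shift_power[OF p that] by metis
  have m0: "?m k u \<noteq> 0 \<longleftrightarrow> (p ^^ k) u \<noteq> (p ^^ (k - 1)) u" if "k \<ge> 1" "u \<in> V" for k u
    using iterated_weight_nonzero_iff[OF p l that(2), where k = "k - 1"] that by (cases k) auto
  \<comment> \<open>An infinite sum in \<open>ennreal\<close> is the supremum of its finite partial
    sums, which gives exactly the finite-sum form of the fibre criterion.\<close>
  have h: "h_sum V p l k v \<le> 1 \<longleftrightarrow>
      (\<forall>F. finite F \<longrightarrow> F \<subseteq> ?fib k v \<longrightarrow> (\<Sum>u\<in>F. (cmod (?m k u))\<^sup>2 / ?a k u) \<le> 1)"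
    if k: "k \<ge> 1" for k v
  proof -
    let ?b = "\<lambda>u. (cmod (?m k u))\<^sup>2 / ?a k u"
    have b: "0 \<le> ?b u" for u
      by (simp add: a[OF k])
    \<comment> \<open>The fibre exceeds \<open>Chi V p k v\<close> only by points that already reach
      \<open>v\<close> after \<open>k - 1\<close> steps; there \<open>m0\<close> makes the summand
      0.\<close>
    have "h_sum V p l k v = (\<Sum>\<^sub>\<infinity>u\<in>?fib k v. ennreal (?b u))"
      unfolding h_sum_def
      by (rule infsum_cong_neutral) (use m0[OF k] in \<open>auto simp: Chi_def fib[OF k] a[OF k]\<close>)
    also have "\<dots> = (SUP F\<in>{F. finite F \<and> F \<subseteq> ?fib k v}. \<Sum>u\<in>F. ennreal (?b u))"
      by (rule nonneg_infsum_complete) simp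
    also have "\<dots> = (SUP F\<in>{F. finite F \<and> F \<subseteq> ?fib k v}. ennreal (\<Sum>u\<in>F. ?b u))"
      using b by (simp add: sum_ennreal)
    finally show ?thesis
      by (auto simp: SUP_le_iff)
  qed
  show ?thesis
  proof (intro iffI conjI ballI allI impI)
    assume hyp: "power_hyponormal V ?S"
    have hypk: "hyponormal V (weighted_shift V (p ^^ k) (?m k))" if "k \<ge> 1" for k
      using hyp that weighted_shift_power[OF p that] unfolding power_hyponormal_def by metis
    show "leafless V p"
      unfolding leafless_def
    proof
      show "p ` V \<subseteq> V" using p by auto
      show "V \<subseteq> p ` V"
      proof
        fix u assume u: "u \<in> V"
        show "u \<in> p ` V"
        proof (rule ccontr)
          assume notin: "u \<notin> p ` V"
          \<comment> \<open>A leaf is annihilated by the shift, so the criterion for the first power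
            makes its weight 0. Properness then makes it a root, and a root is its own image under
            \<open>p\<close>.\<close>
          then have "?S (basis_vec u) = (\<lambda>_. 0)"
            by (auto simp: weighted_shift_def basis_vec_def fun_eq_iff)
          then have "?a 1 u = 0"
            using a[of 1 u] by (simp add: ell2_norm_def)
          then have "?m 1 u = 0"
            using bounded_shift.hyponormal_imp_a_nonzero[OF shift hypk u, of 1] by simp
          then have "p u = u"
            using l[OF u] by simp
          then show False using notin u by (metis imageI)
        qed
      qed
    qed
    fix v and k :: nat assume v: "v \<in> V" and k: "1 \<le> k"
    show "h_sum V p l k v \<le> 1"
      unfolding h[OF k]
      using bounded_shift.hyponormal_imp_sum_le[OF shift[OF k] hypk[OF k] v] by blast
  next
    assume R: "leafless V p \<and> (\<forall>v\<in>V. \<forall>k\<ge>1. h_sum V p l k v \<le> 1)"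
    show "power_hyponormal V ?S"
      unfolding power_hyponormal_def
    proof (intro allI impI)
      fix k :: nat assume k: "1 \<le> k"
      have "hyponormal V (weighted_shift V (p ^^ k) (?m k))"
      proof (rule bounded_shift.hyponormalI[OF shift[OF k]])
        fix u assume u: "u \<in> V" and a0: "?a k u = 0"
        show "?m k u = 0"
        proof (rule ccontr)
          assume nz: "?m k u \<noteq> 0"
          \<comment> \<open>Since \<open>a\<close> at \<open>u\<close> dominates the squared weights
            on the fibre of \<open>u\<close>, the weight at \<open>w\<close> vanishes. Hence the
            path from \<open>w\<close> is at \<open>u\<close> after both \<open>k - 1\<close> and
            \<open>k\<close> steps, so \<open>u\<close> is a root and its own weight is 0.\<close>
          obtain w where w: "w \<in> V" "(p ^^ k) w = u"
            using leafless_funpow R u by metis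
          have "?m k w = 0"
            using bounded_shift.weight_le_a[OF shift[OF k] w(1)] a0 w(2) by simp
          then have "u = (p ^^ (k - 1)) w"
            using m0[OF k w(1)] w(2) by simp
          then have "p u = u"
            using w(2) k by (cases k) auto
          then show False
            using m0[OF k u] nz by (simp add: funpow_root)
        qed
      next
        fix v F assume "v \<in> V" "finite F" "F \<subseteq> ?fib k v"
        then show "(\<Sum>u\<in>F. (cmod (?m k u))\<^sup>2 / ?a k u) \<le> 1"
          using R h[OF k, of v] k by blast
      qed
      then show "hyponormal V (?S ^^ k)"
        using weighted_shift_power[OF p k] by metis
    qed
  qed
qed

end
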